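(* As formal power series in $q$, \[ (-q;q)_\infty = \sum_{n\geq k\geq 0} q^{(2n+1)n + 3k}\, Y_{q^2}(2n+1-k,k)\,(q^2;q^2)_{2n+1}^{-1}\,[2(n-k)+2]_q . \]
   Context: $(a;q)_k=\prod_{j=0}^{k-1}(1-aq^j)$, $(a;q)_0=1$, $(a;q)_\infty=\prod_{j\ge0}(1-aq^j)$ (and likewise with base $q^2$). For $m\ge 0$: $[m]_q=1+q+\cdots+q^{m-1}$, $[m]_q!=[m]_q[m-1]_q\cdots[1]_q$, and for $m\ge j\ge 0$, $\begin{bmatrix} m\\ j\end{bmatrix}_q=\frac{[m]_q!}{[j]_q![m-j]_q!}$. For $m\ge j\ge 0$ the $q$-Yamanouchi number is $Y_q(m,j)=\frac{[m-j+1]_q}{[m+1]_q}\begin{bmatrix} m+j\\ m\end{bmatrix}_q$; $Y_{q^2}$ denotes this with $q$ replaced by $q^2$. *)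

theory Defs
  imports "HOL-Analysis.Analysis" "HOL-Computational_Algebra.Formal_Power_Series"
begin

text \<open>
  The definitions are stated for an arbitrary base \<open>q\<close>, so that base \<open>q\<^sup>2\<close> is plain instantiation.
  They are meant to be used in formal power series over a field, with \<open>q\<close> a power of
  \<open>fps_X\<close>.  There \<open>[m]\<^sub>q\<close> has constant coefficient 1 for \<open>m \<ge> 1\<close>, so the divisions
  below are exact divisions by units.
\<close>

definition qpoch :: "'a::comm_ring_1 \<Rightarrow> 'a \<Rightarrow> nat \<Rightarrow> 'a" where
  "qpoch a q k = (\<Prod>j<k. 1 - a * q ^ j)"

text \<open>For formal power series, the limit in \<^const>\<open>prodinf\<close> is taken in the \<open>X\<close>-adic topology,
  which the library puts on \<^typ>\<open>'a fps\<close>.\<close>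
definition qpoch_inf :: "'a::{comm_ring_1, t2_space} \<Rightarrow> 'a \<Rightarrow> 'a" where
  "qpoch_inf a q = prodinf (\<lambda>j. 1 - a * q ^ j)"

definition qint :: "'a::comm_ring_1 \<Rightarrow> nat \<Rightarrow> 'a" where
  "qint q m = (\<Sum>i<m. q ^ i)"

definition qfact :: "'a::comm_ring_1 \<Rightarrow> nat \<Rightarrow> 'a" where
  "qfact q m = (\<Prod>i=1..m. qint q i)"

text \<open>Only meaningful for \<open>j \<le> m\<close>, as in the usual definition of the Gaussian binomial
  by \<open>q\<close>-factorials; the subtraction is on \<^typ>\<open>nat\<close>.\<close>
definition qbinom :: "'a::{comm_ring_1, inverse} \<Rightarrow> nat \<Rightarrow> nat \<Rightarrow> 'a" where
  "qbinom q m j = qfact q m / (qfact q j * qfact q (m - j))"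

text \<open>The \<open>q\<close>-Yamanouchi number \<open>Y\<^sub>q(m, j)\<close>, only meaningful for \<open>j \<le> m\<close>.\<close>
definition qYam :: "'a::{comm_ring_1, inverse} \<Rightarrow> nat \<Rightarrow> nat \<Rightarrow> 'a" where
  "qYam q m j = qint q (m - j + 1) / qint q (m + 1) * qbinom q (m + j) m"

end

theory Submission
  imports Defs
begin

text \<open>
  Put \<open>N = 2n + 1\<close>. Since \<open>q\<^sup>2\<^sup>k Y\<close> is a difference of consecutive Gaussian binomials in base
  \<open>q\<^sup>2\<close>, Abel summation over \<open>k\<close> turns the inner sum into the Rogers--Szego polynomial
  \<open>\<Sum>\<^sub>k q\<^sup>k [N, k]\<close> in base \<open>q\<^sup>2\<close>, which equals \<open>(-q; q)\<^sub>N\<close>. As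
  \<open>(q\<^sup>2; q\<^sup>2)\<^sub>N = (-q; q)\<^sub>N (q; q)\<^sub>N\<close>, what remains is the sum over odd \<open>N\<close> of
  \<open>q\<close> to the power \<open>N(N - 1)/2\<close> over \<open>(q; q)\<^sub>N\<close>. This is the odd part of Euler's series for
  \<open>(-x; q)\<^sub>\<infinity>\<close> at \<open>x = 1\<close>, half of \<open>(-1; q)\<^sub>\<infinity> - (1; q)\<^sub>\<infinity> = 2 (-q; q)\<^sub>\<infinity>\<close>; it is obtained as the
  \<open>X\<close>-adic limit of the finite \<open>q\<close>-binomial theorem.
\<close>

section \<open>q-shifted factorials and q-integers\<close>

lemma qpoch_0 [simp]: "qpoch a q 0 = 1"
  by (simp add: qpoch_def)

lemma qpoch_Suc: "qpoch a q (Suc k) = qpoch a q k * (1 - a * q ^ k)"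
  by (simp add: qpoch_def)

lemma qpoch_Suc_shift: "qpoch a q (Suc k) = (1 - a) * qpoch (a * q) q k"
  unfolding qpoch_def prod.lessThan_Suc_shift by (simp add: mult.assoc)

lemma qpoch_add: "qpoch a q (m + n) = qpoch a q m * (\<Prod>j=m..<m + n. 1 - a * q ^ j)"
  unfolding qpoch_def lessThan_atLeast0 by (simp add: prod.atLeastLessThan_concat)

lemma qpoch_square: "qpoch (q\<^sup>2) (q\<^sup>2) n = qpoch (- q) q n * qpoch q q n"
  unfolding qpoch_def prod.distrib[symmetric]
  by (intro prod.cong) (simp_all add: algebra_simps power2_eq_square)

lemma one_minus_mult_qint: "(1 - q) * qint q m = 1 - q ^ m"
  by (simp add: qint_def one_diff_power_eq)

lemma qint_add: "qint q (m + n) = qint q m + q ^ m * qint q n"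
  by (induction n) (simp_all add: qint_def algebra_simps power_add)

lemma qfact_0 [simp]: "qfact q 0 = 1"
  by (simp add: qfact_def)

lemma qfact_Suc: "qfact q (Suc n) = qfact q n * qint q (Suc n)"
  by (simp add: qfact_def)

lemma qpoch_eq_qfact: "qpoch q q n = (1 - q) ^ n * qfact q n"
proof (induction n)
  case (Suc n)
  have "1 - q * q ^ n = (1 - q) * qint q (Suc n)"
    by (simp add: one_minus_mult_qint)
  with Suc show ?case
    by (simp add: qpoch_Suc qfact_Suc mult_ac)
qed simp

section \<open>Gaussian binomials as polynomials\<close>

text \<open>Unlike \<^const>\<open>qbinom\<close>, this form of the Gaussian binomial needs no division.\<close>

fun gbin :: "'a::comm_ring_1 \<Rightarrow> nat \<Rightarrow> nat \<Rightarrow> 'a" where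
  "gbin q n 0 = 1"
| "gbin q 0 (Suc k) = 0"
| "gbin q (Suc n) (Suc k) = gbin q n k + q ^ Suc k * gbin q n (Suc k)"

lemma gbin_eq_0: "n < k \<Longrightarrow> gbin q n k = 0"
  by (induction q n k rule: gbin.induct) auto

lemma gbin_self [simp]: "gbin q n n = 1"
  by (induction n) (simp_all add: gbin_eq_0)

text \<open>Mirror image of the defining Pascal rule. Expand by that rule, apply the induction
  hypothesis to both terms and regroup; the cross terms match because both carry the power
  \<open>q ^ (n + 1)\<close>.\<close>

lemma gbin_Suc_Suc':
  "k \<le> n \<Longrightarrow> gbin q (Suc n) (Suc k) = gbin q n (Suc k) + q ^ (n - k) * gbin q n k"
proof (induction n arbitrary: k)
  case (Suc n)
  show ?case
  proof (cases k)
    case 0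
    then show ?thesis using Suc.IH[of 0] by (simp add: algebra_simps)
  next
    case (Suc j)
    show ?thesis
    proof (cases "j = n")
      case True
      then show ?thesis by (simp add: Suc gbin_eq_0)
    next
      case False
      with Suc Suc.prems have j: "Suc j \<le> n" by simp
      have *: "q ^ Suc (Suc j) * q ^ (n - Suc j) = q ^ (n - j) * q ^ Suc j"
        using j by (simp only: power_add[symmetric], intro arg_cong[of _ _ "power q"]) simp
      have "gbin q (Suc (Suc n)) (Suc (Suc j)) = gbin q (Suc n) (Suc j) + q ^ Suc (Suc j) * gbin q (Suc n) (Suc (Suc j))"
        by simp
      also have "\<dots> = (gbin q n (Suc j) + q ^ (n - j) * gbin q n j)
          + q ^ Suc (Suc j) * (gbin q n (Suc (Suc j)) + q ^ (n - Suc j) * gbin q n (Suc j))"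
        using j by (simp only: Suc.IH[of j] Suc.IH[of "Suc j"] Suc_leD)
      also have "\<dots> = (gbin q n (Suc j) + q ^ Suc (Suc j) * gbin q n (Suc (Suc j)))
          + q ^ (n - j) * gbin q n j + (q ^ Suc (Suc j) * q ^ (n - Suc j)) * gbin q n (Suc j)"
        by (simp only: ring_distribs ac_simps)
      also have "\<dots> = gbin q (Suc n) (Suc (Suc j)) + q ^ (n - j) * gbin q (Suc n) (Suc j)"
        unfolding * by (simp add: algebra_simps)
      finally show ?thesis by (simp add: Suc)
    qed
  qed
qed simp

text \<open>Reflecting \<open>k\<close> to \<open>n - k\<close> exchanges the two Pascal
  rules.\<close>

lemma gbin_symmetric: "k \<le> n \<Longrightarrow> gbin q n (n - k) = gbin q n k"
proof (induction n arbitrary: k)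
  case (Suc n)
  show ?case
  proof (cases k)
    case (Suc i)
    show ?thesis
    proof (cases "i = n")
      case False
      with Suc Suc.prems have i: "Suc i \<le> n" by simp
      then have e: "Suc n - Suc i = Suc (n - Suc i)" "Suc (n - Suc i) = n - i" by auto
      have "gbin q (Suc n) (Suc n - Suc i) = gbin q n (n - Suc i) + q ^ (n - i) * gbin q n (n - i)"
        unfolding e(1) gbin.simps(3) by (simp only: e(2))
      also have "\<dots> = gbin q n (Suc i) + q ^ (n - i) * gbin q n i"
        using i by (simp only: Suc.IH Suc_leD)
      also have "\<dots> = gbin q (Suc n) (Suc i)"
        using i by (subst gbin_Suc_Suc') auto
      finally show ?thesis by (simp add: Suc)
    qed (simp add: Suc)
  qed simp
qed simp

text \<open>The Pascal rule mirrors the splitting \<open>qint_add\<close> of \<open>[m + n]\<close>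
  into \<open>[m] + q^m [n]\<close>.\<close>

lemma gbin_mult_qfact: "gbin q (m + n) m * (qfact q m * qfact q n) = qfact q (m + n)"
proof (induction "m + n" arbitrary: m n)
  case (Suc s)
  show ?case
  proof (cases "m = 0 \<or> n = 0")
    case False
    then obtain i j where ij: "m = Suc i" "n = Suc j"
      by (metis not0_implies_Suc)
    have s: "i + n = s" "m + j = s" "m + n = Suc s" using Suc ij by auto
    note IH = Suc.hyps(1)[OF s(1)[symmetric]] Suc.hyps(1)[OF s(2)[symmetric]]
    have "gbin q (m + n) m * (qfact q m * qfact q n)
        = (gbin q s i * (qfact q i * qfact q n)) * qint q m
          + q ^ m * ((gbin q s m * (qfact q m * qfact q j)) * qint q n)"
      unfolding s unfolding ij gbin.simps qfact_Suc by (simp only: ring_distribs ac_simps)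
    also have "\<dots> = qfact q s * (qint q m + q ^ m * qint q n)"
      using IH unfolding s by (simp add: algebra_simps)
    also have "\<dots> = qfact q (m + n)"
      by (simp only: qint_add[symmetric] s qfact_Suc)
    finally show ?thesis .
  qed auto
qed simp

lemma gbin_mult_qpoch: "gbin q (m + n) m * (qpoch q q m * qpoch q q n) = qpoch q q (m + n)"
proof -
  have "gbin q (m + n) m * (qpoch q q m * qpoch q q n)
      = (1 - q) ^ (m + n) * (gbin q (m + n) m * (qfact q m * qfact q n))"
    by (simp add: qpoch_eq_qfact power_add mult_ac)
  then show ?thesis
    by (simp only: gbin_mult_qfact qpoch_eq_qfact)
qed

section \<open>q-binomial theorem, Rogers-Szego sums and Abel summation\<close>

lemma gbin_theorem:
  "(\<Sum>k\<le>n. q ^ (k choose 2) * gbin q n k * x ^ k) = qpoch (- x) q n"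
proof (induction n arbitrary: x)
  case (Suc n)
  \<comment> \<open>The induction hypothesis is used at \<open>x * q\<close>, because
    \<open>qpoch_Suc_shift\<close> splits off the first factor of the product.\<close>
  let ?t = "\<lambda>k. q ^ (k choose 2) * gbin q n k * (x * q) ^ k"
  have *: "q ^ (Suc k choose 2) * gbin q (Suc n) (Suc k) * x ^ Suc k = x * ?t k + ?t (Suc k)" for k
    by (simp add: numeral_2_eq_2 power_add algebra_simps)
  have "(\<Sum>k\<le>Suc n. q ^ (k choose 2) * gbin q (Suc n) k * x ^ k)
      = 1 + (\<Sum>k\<le>n. x * ?t k + ?t (Suc k))"
    unfolding sum.atMost_Suc_shift * by (simp add: numeral_2_eq_2)
  also have "\<dots> = x * (\<Sum>k\<le>n. ?t k) + (\<Sum>k\<le>Suc n. ?t k)"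
    unfolding sum.atMost_Suc_shift by (simp add: sum.distrib sum_distrib_left numeral_2_eq_2)
  also have "\<dots> = (1 + x) * (\<Sum>k\<le>n. ?t k)"
    by (simp add: gbin_eq_0 algebra_simps)
  finally show ?case
    by (simp add: Suc qpoch_Suc_shift)
qed (simp add: numeral_2_eq_2)

text \<open>In base \<open>q^2\<close> the Pascal rule turns the weight \<open>q^k\<close> into
  \<open>q^(3k)\<close>, so the two sums are evaluated together by a coupled recurrence.\<close>

lemma rogers_szego:
  "(\<Sum>k\<le>n. q ^ k * gbin (q\<^sup>2) n k) = qpoch (- q) q n"
  and rogers_szego_shift:
  "(\<Sum>k\<le>n. q ^ (3 * k) * gbin (q\<^sup>2) n k) = qpoch (- q) q n * (1 + q ^ Suc n - q)"
proof (induction n)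
  case (Suc n)
  let ?g = "gbin (q\<^sup>2)"
  let ?A = "\<lambda>n. \<Sum>k\<le>n. q ^ k * ?g n k" and ?B = "\<lambda>n. \<Sum>k\<le>n. q ^ (3 * k) * ?g n k"
  have t: "q ^ Suc k * ?g (Suc n) (Suc k)
      = q * (q ^ k * ?g n k) + q ^ (3 * Suc k) * ?g n (Suc k)" for k
  proof -
    have "q ^ (3 * Suc k) = q ^ Suc k * (q\<^sup>2) ^ Suc k"
      unfolding power_mult[symmetric] power_add[symmetric] by (intro arg_cong[of _ _ "power q"]) simp
    then show ?thesis by (simp only: gbin.simps ring_distribs power_Suc mult.assoc)
  qed
  have "?A (Suc n) = q * ?A n + (\<Sum>k\<le>Suc n. q ^ (3 * k) * ?g n k)"
    unfolding sum.atMost_Suc_shift t by (simp add: sum.distrib sum_distrib_left)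
  then have A: "?A (Suc n) = q * ?A n + ?B n"
    by (simp add: gbin_eq_0)
  \<comment> \<open>The mirrored Pascal rule returns to the weight \<open>q^k\<close>, since
    \<open>3(k + 1) + 2(n - k) = (2n + 3) + k\<close>.\<close>
  have t': "q ^ (3 * Suc k) * ?g (Suc n) (Suc k)
      = q ^ (2 * n + 3) * (q ^ k * ?g n k) + q ^ (3 * Suc k) * ?g n (Suc k)" if "k \<le> n" for k
  proof -
    have "q ^ (3 * Suc k) * (q\<^sup>2) ^ (n - k) = q ^ (2 * n + 3) * q ^ k"
      unfolding power_mult[symmetric] power_add[symmetric]
      using that by (intro arg_cong[of _ _ "power q"]) simp
    then show ?thesis
      unfolding gbin_Suc_Suc'[OF that] by (simp only: ring_distribs mult.assoc[symmetric] add.commute)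
  qed
  have "?B (Suc n) = q ^ (2 * n + 3) * ?A n + (\<Sum>k\<le>Suc n. q ^ (3 * k) * ?g n k)"
    unfolding sum.atMost_Suc_shift using t' by (simp add: sum.distrib sum_distrib_left cong: sum.cong_simp)
  then have B: "?B (Suc n) = q ^ (2 * n + 3) * ?A n + ?B n"
    by (simp add: gbin_eq_0)
  { case 1
    show ?case unfolding A Suc by (simp add: qpoch_Suc algebra_simps) }
  { case 2
    have "q ^ (2 * n + 3) = q ^ (n + n + 3)"
      by (intro arg_cong[of _ _ "power q"]) simp
    also have "\<dots> = q * (q ^ n * (q * (q ^ n * q)))"
      by (simp only: power_add power3_eq_cube mult_ac)
    finally have "q ^ (2 * n + 3) = q * (q ^ n * (q * (q ^ n * q)))" .
    then show ?case unfolding B Suc by (simp add: qpoch_Suc algebra_simps) }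
qed simp_all

text \<open>Abel summation; the boundary term vanishes because the weights
  \<open>q ^ k - q ^ (2 * n + 2 - k)\<close> change sign at \<open>k = n + 1\<close>.\<close>

lemma sum_by_parts_symmetric:
  fixes q :: "'a::comm_ring_1" and g :: "nat \<Rightarrow> 'a"
  assumes sym: "\<And>k. k \<le> n \<Longrightarrow> g (2 * n + 1 - k) = g k"
  shows "(\<Sum>k\<le>n. (g k - (if k = 0 then 0 else g (k - 1))) * (q ^ k - q ^ (2 * n + 2 - k)))
    = (1 - q) * (\<Sum>k\<le>2 * n + 1. q ^ k * g k)"
proof -
  let ?E = "\<lambda>k. q ^ k - q ^ (2 * n + 2 - k)"
  have part: "(\<Sum>k\<le>m. (g k - (if k = 0 then 0 else g (k - 1))) * ?E k)
      = (\<Sum>k\<le>m. g k * (?E k - ?E (Suc k))) + g m * ?E (Suc m)" for m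
    by (induction m) (simp_all add: algebra_simps)
  have E: "?E k - ?E (Suc k) = (1 - q) * (q ^ k + q ^ (2 * n + 1 - k))" if "k \<le> n" for k
  proof -
    have "2 * n + 2 - k = Suc (2 * n + 1 - k)" "2 * n + 2 - Suc k = 2 * n + 1 - k" using that by auto
    then show ?thesis by (simp add: algebra_simps)
  qed
  have "(\<Sum>k\<le>n. (g k - (if k = 0 then 0 else g (k - 1))) * ?E k)
      = (1 - q) * (\<Sum>k\<le>n. q ^ k * g k + q ^ (2 * n + 1 - k) * g (2 * n + 1 - k))"
    unfolding part using E sym by (simp add: sum_distrib_left algebra_simps cong: sum.cong_simp)
  \<comment> \<open>The reflected terms are exactly the upper half of the full sum.\<close>
  moreover have "(\<Sum>k\<le>n. q ^ (2 * n + 1 - k) * g (2 * n + 1 - k)) = (\<Sum>k=Suc n..2 * n + 1. q ^ k * g k)"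
    by (rule sum.reindex_bij_witness[of _ "\<lambda>k. 2 * n + 1 - k" "\<lambda>k. 2 * n + 1 - k"]) auto
  moreover have "(\<Sum>k\<le>2 * n + 1. q ^ k * g k)
      = (\<Sum>k\<le>n. q ^ k * g k) + (\<Sum>k=Suc n..2 * n + 1. q ^ k * g k)"
    by (subst sum.union_disjoint[symmetric]) (auto intro!: sum.cong simp del: sum.atMost_Suc)
  ultimately show ?thesis by (simp only: sum.distrib)
qed


section \<open>q-Yamanouchi numbers and the inner sum\<close>

lemma qint_nth_0 [simp]: "fps_nth q 0 = 0 \<Longrightarrow> fps_nth (qint q (Suc m)) 0 = 1"
  using qint_add[of q 1 m] by (simp add: qint_def)

lemma qfact_nth_0 [simp]: "fps_nth q 0 = 0 \<Longrightarrow> fps_nth (qfact q n) 0 = 1"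
  by (induction n) (simp_all add: qfact_Suc)

lemma qpoch_nth_0 [simp]: "fps_nth a 0 = 0 \<Longrightarrow> fps_nth (qpoch a q n) 0 = 1"
  by (induction n) (simp_all add: qpoch_Suc)

lemma qbinom_eq_gbin:
  fixes q :: "'a::field fps"
  assumes "fps_nth q 0 = 0" and "k \<le> n"
  shows "qbinom q n k = gbin q n k"
proof -
  have "fps_nth (qfact q k * qfact q (n - k)) 0 = 1" using assms by simp
  then have "qfact q k * qfact q (n - k) \<noteq> 0" by force
  moreover have "qfact q n = gbin q n k * (qfact q k * qfact q (n - k))"
    using gbin_mult_qfact[of q k "n - k"] assms by simp
  ultimately show ?thesis
    unfolding qbinom_def by (metis nonzero_mult_div_cancel_right)
qed

text \<open>Ratio of neighbouring Gaussian binomials: multiplied by \<open>[j]! [m]!\<close>, both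
  sides become \<open>[j + m + 1]!\<close>.\<close>

lemma gbin_mult_qint:
  fixes q :: "'a::field fps"
  assumes "fps_nth q 0 = 0"
  shows "gbin q (Suc (j + m)) j * qint q (Suc m) = gbin q (Suc (j + m)) (Suc j) * qint q (Suc j)"
proof -
  let ?c = "qfact q j * qfact q m"
  have "fps_nth ?c 0 = 1" using assms by simp
  then have "?c \<noteq> 0" by force
  moreover have "(gbin q (Suc (j + m)) j * qint q (Suc m)) * ?c
      = (gbin q (Suc (j + m)) (Suc j) * qint q (Suc j)) * ?c"
    using gbin_mult_qfact[of q j "Suc m"] gbin_mult_qfact[of q "Suc j" m]
    by (simp add: qfact_Suc mult_ac del: gbin.simps)
  ultimately show ?thesis by (metis mult_right_cancel)
qed

text \<open>A q-analogue of the ballot number as a difference of binomials. After multiplication by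
  \<open>[n - k + 1]\<close> it reduces to
  \<open>[n - k + 1] - [k] = q^k [n - 2k + 1]\<close>.\<close>

lemma qYam_eq_gbin_diff:
  fixes q :: "'a::field fps"
  assumes q: "fps_nth q 0 = 0" and k: "2 * k \<le> n"
  shows "q ^ k * qYam q (n - k) k = gbin q n k - (if k = 0 then 0 else gbin q n (k - 1))"
proof -
  let ?d = "qint q (n - k + 1)" and ?g' = "if k = 0 then 0 else gbin q n (k - 1)"
  have d0: "fps_nth ?d 0 \<noteq> 0" using q by simp
  \<comment> \<open>Being a unit, \<open>?d\<close> makes the division in \<open>qYam\<close>
    exact.\<close>
  then have d: "?d \<noteq> 0" "?d dvd 1" by (force, simp)
  have g': "?g' * ?d = gbin q n k * qint q k"
  proof (cases k)
    case (Suc j)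
    then show ?thesis
      using gbin_mult_qint[OF q, of j "n - k"] k by simp
  qed (simp add: qint_def)
  have Y: "?d * qYam q (n - k) k = qint q (n - 2 * k + 1) * gbin q n k"
  proof -
    have "qbinom q (n - k + k) (n - k) = gbin q n k"
      using k q by (simp add: qbinom_eq_gbin gbin_symmetric)
    moreover have "?d * (qint q (n - 2 * k + 1) / ?d) = qint q (n - 2 * k + 1)"
      using d(2) by (simp add: unit_imp_dvd)
    moreover have "n - k - k = n - 2 * k" by simp
    ultimately show ?thesis
      unfolding qYam_def by (simp add: mult.assoc[symmetric])
  qed
  have "k + (n - 2 * k + 1) = n - k + 1" using k by simp
  then have "?d = qint q k + q ^ k * qint q (n - 2 * k + 1)"
    by (metis qint_add)
  then have "q ^ k * qint q (n - 2 * k + 1) = ?d - qint q k"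
    by (simp add: algebra_simps)
  then have "(q ^ k * qint q (n - 2 * k + 1)) * gbin q n k = (gbin q n k - ?g') * ?d"
    using g' by (simp only: left_diff_distrib right_diff_distrib mult.commute)
  then have "(q ^ k * qYam q (n - k) k) * ?d = (gbin q n k - ?g') * ?d"
    using Y by (simp add: mult_ac)
  then show ?thesis
    using d(1) mult_right_cancel by blast
qed

lemma sum_qYam:
  fixes q :: "'a::field fps"
  assumes q: "fps_nth q 0 = 0"
  shows "(\<Sum>k\<le>n. q ^ ((2*n + 1) * n + 3*k) * qYam (q\<^sup>2) (2*n + 1 - k) k
              * inverse (qpoch (q\<^sup>2) (q\<^sup>2) (2*n + 1)) * qint q (2 * (n - k) + 2))
    = q ^ ((2*n + 1) * n) * inverse (qpoch q q (2*n + 1))"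
    (is "(\<Sum>k\<le>n. ?t k) = _")
proof -
  let ?N = "2 * n + 1" and ?c = "q ^ ((2*n + 1) * n) * inverse (qpoch (q\<^sup>2) (q\<^sup>2) (2*n + 1))"
  let ?g = "gbin (q\<^sup>2) ?N"
  let ?D = "\<lambda>k. ?g k - (if k = 0 then 0 else ?g (k - 1))"
  have q2: "fps_nth (q\<^sup>2) 0 = 0" using q by (simp add: power2_eq_square)
  have "fps_nth (1 - q) 0 = 1" using q by simp
  then have q1: "1 - q \<noteq> 0" by force
  \<comment> \<open>Of \<open>q^(3k)\<close>, the part \<open>(q^2)^k\<close> goes to the Yamanouchi
    number and \<open>q^k\<close> to the weight. The factor \<open>1 - q\<close> turns the q-integer
    into \<open>1 - q^(2(n - k) + 2)\<close>, giving the weights of the Abel summation; it is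
    cancelled at the end.\<close>
  have t: "(1 - q) * ?t k = ?c * (?D k * (q ^ k - q ^ (2 * n + 2 - k)))" if "k \<le> n" for k
  proof -
    let ?m = "2 * (n - k) + 2" and ?Y = "qYam (q\<^sup>2) (2*n + 1 - k) k"
    have D: "(q\<^sup>2) ^ k * ?Y = ?D k"
      using that by (intro qYam_eq_gbin_diff q2) simp
    have e: "k + ?m = 2 * n + 2 - k" using that by simp
    have "(1 - q) * ?t k = ?c * (((q\<^sup>2) ^ k * ?Y) * (q ^ k * ((1 - q) * qint q ?m)))"
    proof -
      have "q ^ (?N * n + 3 * k) = q ^ (?N * n) * ((q\<^sup>2) ^ k * q ^ k)"
        unfolding power_mult[symmetric] power_add[symmetric] by (intro arg_cong[of _ _ "power q"]) simp
      then show ?thesis by (simp only: mult_ac)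
    qed
    also have "\<dots> = ?c * (?D k * (q ^ k - q ^ (2 * n + 2 - k)))"
      unfolding D one_minus_mult_qint right_diff_distrib[of "q ^ k"] power_add[symmetric] e by simp
    finally show ?thesis .
  qed
  have "(1 - q) * (\<Sum>k\<le>n. ?t k) = ?c * (\<Sum>k\<le>n. ?D k * (q ^ k - q ^ (2 * n + 2 - k)))"
    unfolding sum_distrib_left using t by (intro sum.cong) auto
  also have "\<dots> = ?c * ((1 - q) * qpoch (- q) q ?N)"
    by (subst sum_by_parts_symmetric) (simp_all add: rogers_szego gbin_symmetric del: sum.atMost_Suc gbin.simps)
  also have "\<dots> = (1 - q) * (q ^ (?N * n) * (qpoch (- q) q ?N * inverse (qpoch (- q) q ?N)) * inverse (qpoch q q ?N))"
    unfolding qpoch_square fps_inverse_mult by (simp only: mult_ac)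
  also have "qpoch (- q) q ?N * inverse (qpoch (- q) q ?N) = 1"
    using q by (simp add: inverse_mult_eq_1' del: One_nat_def)
  finally show ?thesis
    using q1 by (simp del: sum.atMost_Suc)
qed

section \<open>Congruences modulo powers of \<open>q\<close> and Euler's series\<close>

lemma dvd_prod_minus_1:
  fixes d :: "'a::comm_ring_1"
  assumes "\<And>i. i \<in> A \<Longrightarrow> d dvd f i - 1"
  shows "d dvd prod f A - 1"
  using assms
proof (induction A rule: infinite_finite_induct)
  case (insert x A)
  have eq: "prod f (insert x A) - 1 = (f x - 1) * prod f A + (prod f A - 1)"
    using insert.hyps by (simp add: algebra_simps)
  show ?case
    unfolding eq using insert by (intro dvd_add dvd_mult2) auto
qed simp_all

lemma nth_eq_if_dvd_diff:
  fixes f g :: "'a::comm_ring_1 fps"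
  assumes "fps_X ^ n dvd f - g" and "m < n"
  shows "fps_nth f m = fps_nth g m"
proof -
  from assms(1) obtain h where "f - g = fps_X ^ n * h" ..
  then have "fps_nth (f - g) m = 0"
    using assms(2) by (simp add: fps_X_power_mult_nth)
  then show ?thesis by simp
qed

text \<open>Quantifies the convergence of Gaussian binomials to \<open>1/(q;q)_k\<close> as
  \<open>n\<close> grows: the two differ by the factor \<open>?P\<close>, all of whose factors are 1
  modulo \<open>q^(n - k + 1)\<close>.\<close>

lemma dvd_gbin_diff:
  fixes q :: "'a::field fps"
  assumes q: "fps_nth q 0 = 0" and "k \<le> n"
  shows "q ^ (n - k + 1) dvd inverse (qpoch q q k) - gbin q n k"
proof -
  let ?P = "\<Prod>j=n - k..<n. 1 - q * q ^ j"
  have u: "fps_nth (qpoch q q m) 0 \<noteq> 0" for m using q by simp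
  have "qpoch q q (n - k) * (gbin q n k * qpoch q q k) = qpoch q q (n - k) * ?P"
    using gbin_mult_qpoch[of q k "n - k"] qpoch_add[of q q "n - k" k] assms(2) by (simp add: mult_ac)
  moreover have "qpoch q q (n - k) \<noteq> 0" using u[of "n - k"] by force
  ultimately have "?P = gbin q n k * qpoch q q k" by simp
  then have "inverse (qpoch q q k) * ?P = gbin q n k * (inverse (qpoch q q k) * qpoch q q k)"
    by (simp only: mult_ac)
  also have "inverse (qpoch q q k) * qpoch q q k = 1"
    using u by (rule inverse_mult_eq_1)
  finally have eq: "inverse (qpoch q q k) - gbin q n k = - inverse (qpoch q q k) * (?P - 1)"
    by (simp add: algebra_simps)
  have "q ^ (n - k + 1) dvd ?P - 1"
    by (rule dvd_prod_minus_1) (auto simp del: power_Suc simp flip: power_Suc intro!: le_imp_power_dvd)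
  then show ?thesis unfolding eq by (rule dvd_mult)
qed

text \<open>Odd part in \<open>x\<close> of the finite Euler product, at \<open>x = 1\<close>: the product at \<open>x = - 1\<close> vanishes.\<close>

lemma sum_odd_gbin:
  fixes q :: "'a::{idom, semiring_char_0}"
  shows "(\<Sum>n\<le>m. q ^ ((2 * n + 1) * n) * gbin q (2 * m + 1) (2 * n + 1)) = qpoch (- q) q (2 * m)"
proof -
  let ?M = "2 * m + 1"
  let ?f = "\<lambda>k. q ^ (k choose 2) * gbin q ?M k"
  have c: "(2 * n + 1) choose 2 = (2 * n + 1) * n" for n :: nat
    by (simp add: choose_two)
  have "2 * (\<Sum>n\<le>m. ?f (2 * n + 1)) = (\<Sum>n\<le>m. ?f (2 * n + 1) + ?f (2 * n + 1))"
    by (simp only: sum.distrib mult_2)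
  also have "\<dots> = (\<Sum>k | k \<le> ?M \<and> odd k. ?f k + ?f k)"
    by (rule sum.reindex_bij_witness[of _ "\<lambda>k. k div 2" "\<lambda>n. 2 * n + 1"]) auto
  also have "\<dots> = (\<Sum>k\<le>?M. ?f k * 1 ^ k - ?f k * (- 1) ^ k)"
    by (intro sum.mono_neutral_cong_left) auto
  also have "\<dots> = qpoch (- 1) q ?M - qpoch 1 q ?M"
    by (simp only: sum_subtractf gbin_theorem minus_minus)
  \<comment> \<open>The first factors of the two products are 2 and 0.\<close>
  also have "\<dots> = 2 * qpoch (- q) q (2 * m)"
    by (simp add: qpoch_Suc_shift)
  finally show ?thesis by (simp only: c mult_cancel_left) simp
qed

text \<open>The factors \<open>1 + X^(j + 1)\<close> with \<open>j \<ge> m\<close> are 1 modulo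
  \<open>X^(m + 1)\<close>.\<close>

lemma qpoch_nth_stable:
  assumes "m \<le> n"
  shows "fps_nth (qpoch (- fps_X) (fps_X :: 'a::comm_ring_1 fps) n) m = fps_nth (qpoch (- fps_X) fps_X m) m"
proof -
  let ?q = "fps_X :: 'a fps"
  let ?P = "\<Prod>j=m..<n. 1 - - ?q * ?q ^ j"
  have "?q ^ Suc m dvd ?P - 1"
    by (rule dvd_prod_minus_1) (auto simp del: power_Suc simp flip: power_Suc intro!: le_imp_power_dvd)
  then have "?q ^ Suc m dvd qpoch (- ?q) ?q m * (?P - 1)" by (rule dvd_mult)
  moreover have "qpoch (- ?q) ?q n = qpoch (- ?q) ?q m * ?P"
    using qpoch_add[of "- ?q" ?q m "n - m"] assms by simp
  ultimately have "?q ^ Suc m dvd qpoch (- ?q) ?q n - qpoch (- ?q) ?q m"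
    by (simp add: algebra_simps)
  then show ?thesis by (rule nth_eq_if_dvd_diff) simp
qed

lemma qpoch_inf_nth:
  "fps_nth (qpoch_inf (- fps_X) (fps_X :: 'a::idom fps)) m = fps_nth (qpoch (- fps_X) fps_X m) m"
proof -
  let ?q = "fps_X :: 'a fps"
  define P where "P = Abs_fps (\<lambda>m. fps_nth (qpoch (- ?q) ?q m) m)"
  have "(\<lambda>n. \<Prod>i\<le>n. 1 - - ?q * ?q ^ i) \<longlonglongrightarrow> P"
  proof (rule tendsto_fpsI)
    fix m
    show "\<forall>\<^sub>F n in sequentially. fps_nth (\<Prod>i\<le>n. 1 - - ?q * ?q ^ i) m = fps_nth P m"
      using eventually_ge_at_top[of m]
    proof eventually_elim
      case (elim n)
      then show ?case
        using qpoch_nth_stable[of m "Suc n", where ?'a = 'a]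
        by (simp add: P_def qpoch_def lessThan_Suc_atMost del: prod.lessThan_Suc)
    qed
  qed
  \<comment> \<open>A nonzero limit is part of the definition of \<open>has_prod\<close>.\<close>
  moreover have "fps_nth P 0 = 1" by (simp add: P_def)
  then have "P \<noteq> 0" by force
  ultimately have "(\<lambda>j. 1 - - ?q * ?q ^ j) has_prod P"
    by (simp add: has_prod_def raw_has_prod_def)
  then have "qpoch_inf (- ?q) ?q = P"
    unfolding qpoch_inf_def by (rule has_prod_unique[symmetric])
  then show ?thesis by (simp add: P_def)
qed

text \<open>Up to degree \<open>m\<close>, each reciprocal may be replaced by a Gaussian binomial of
  row \<open>2m + 1\<close>, which makes \<open>sum_odd_gbin\<close> applicable.\<close>

lemma sum_odd_euler_nth:
  "fps_nth (\<Sum>n\<le>m. fps_X ^ ((2 * n + 1) * n) * inverse (qpoch fps_X fps_X (2 * n + 1))) m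
    = fps_nth (qpoch_inf (- fps_X) (fps_X :: 'a::field_char_0 fps)) m"
proof -
  let ?q = "fps_X :: 'a fps"
  let ?M = "2 * m + 1"
  have "?q ^ Suc m dvd (\<Sum>n\<le>m. ?q ^ ((2 * n + 1) * n) * inverse (qpoch ?q ?q (2 * n + 1)))
      - (\<Sum>n\<le>m. ?q ^ ((2 * n + 1) * n) * gbin ?q ?M (2 * n + 1))"
    unfolding sum_subtractf[symmetric] right_diff_distrib[symmetric]
  proof (rule dvd_sum)
    fix n assume "n \<in> {..m}"
    then have n: "2 * n + 1 \<le> ?M" by simp
    \<comment> \<open>The right-hand side equals \<open>2n^2 - n + 2m + 1\<close>.\<close>
    have "Suc m \<le> (2 * n + 1) * n + (?M - (2 * n + 1) + 1)"
      using n by (cases n) (auto simp: algebra_simps)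
    then have "?q ^ Suc m dvd ?q ^ ((2 * n + 1) * n) * ?q ^ (?M - (2 * n + 1) + 1)"
      unfolding power_add[symmetric] by (rule le_imp_power_dvd)
    also have "\<dots> dvd ?q ^ ((2 * n + 1) * n) * (inverse (qpoch ?q ?q (2 * n + 1)) - gbin ?q ?M (2 * n + 1))"
      using n by (intro mult_dvd_mono dvd_gbin_diff) simp_all
    finally show "?q ^ Suc m dvd \<dots>" .
  qed
  then have "fps_nth (\<Sum>n\<le>m. ?q ^ ((2 * n + 1) * n) * inverse (qpoch ?q ?q (2 * n + 1))) m
      = fps_nth (qpoch (- ?q) ?q (2 * m)) m"
    unfolding sum_odd_gbin by (rule nth_eq_if_dvd_diff) simp
  then show ?thesis
    by (simp only: qpoch_inf_nth qpoch_nth_stable[of m "2 * m"])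
qed

section \<open>Summation over all pairs\<close>

text \<open>Convergence is coefficientwise: the coefficient of degree \<open>m\<close> is the same
  for all finite index sets between \<open>F m\<close> and \<open>A\<close>.\<close>

lemma has_sum_fpsI:
  fixes f :: "'i \<Rightarrow> 'a::comm_ring_1 fps"
  assumes "\<And>m. finite (F m)" "\<And>m. F m \<subseteq> A"
    and "\<And>m i. i \<in> A - F m \<Longrightarrow> fps_nth (f i) m = 0"
    and "\<And>m. fps_nth (sum f (F m)) m = fps_nth S m"
  shows "(f has_sum S) A"
  unfolding has_sum_def
proof (rule tendsto_fpsI)
  fix m
  have "fps_nth (sum f Y) m = fps_nth S m" if "finite Y" "F m \<subseteq> Y" "Y \<subseteq> A" for Y
  proof -
    have "(\<Sum>i\<in>Y. fps_nth (f i) m) = (\<Sum>i\<in>F m. fps_nth (f i) m)"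
      using that assms(3) by (intro sum.mono_neutral_right) auto
    then show ?thesis using assms(4)[of m] by (simp add: fps_sum_nth)
  qed
  then show "\<forall>\<^sub>F Y in finite_subsets_at_top A. fps_nth (sum f Y) m = fps_nth S m"
    unfolding eventually_finite_subsets_at_top
    using assms(1,2)[of m] by (intro exI[of _ "F m"]) simp
qed

theorem theorem3p34:
  fixes q :: "'a::field_char_0 fps"
  defines "q \<equiv> fps_X"
  shows "((\<lambda>(n, k). q ^ ((2*n + 1) * n + 3*k) * qYam (q\<^sup>2) (2*n + 1 - k) k
              * inverse (qpoch (q\<^sup>2) (q\<^sup>2) (2*n + 1)) * qint q (2 * (n - k) + 2))
           has_sum qpoch_inf (- q) q) {(n, k). k \<le> n}"
proof (rule has_sum_fpsI[where F = "\<lambda>m. SIGMA n:{..m}. {..n}"])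
  fix m :: nat and i :: "nat \<times> nat"
  assume "i \<in> {(n, k). k \<le> n} - (SIGMA n:{..m}. {..n})"
  then obtain n k where i: "i = (n, k)" "m < n"
    by (cases i) (auto simp: not_le)
  \<comment> \<open>Terms outside the chosen finite set have order above \<open>m\<close>.\<close>
  have "m < (2 * n + 1) * n + 3 * k" using i(2) by (simp add: algebra_simps)
  then show "fps_nth (case i of (n, k) \<Rightarrow> q ^ ((2*n + 1) * n + 3*k) * qYam (q\<^sup>2) (2*n + 1 - k) k
      * inverse (qpoch (q\<^sup>2) (q\<^sup>2) (2*n + 1)) * qint q (2 * (n - k) + 2)) m = 0"
    unfolding i q_def by (simp only: prod.case mult.assoc fps_X_power_mult_nth if_True)
next
  fix m :: nat
  \<comment> \<open>Summing over \<open>k\<close> first brings in \<open>sum_qYam\<close> and leaves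
    the truncated odd Euler series.\<close>
  have "fps_nth q 0 = 0" by (simp add: q_def)
  then show "fps_nth (\<Sum>(n, k)\<in>(SIGMA n:{..m}. {..n}). q ^ ((2*n + 1) * n + 3*k)
      * qYam (q\<^sup>2) (2*n + 1 - k) k * inverse (qpoch (q\<^sup>2) (q\<^sup>2) (2*n + 1))
      * qint q (2 * (n - k) + 2)) m = fps_nth (qpoch_inf (- q) q) m"
    by (subst sum.Sigma[symmetric]) (simp_all only: sum_qYam q_def sum_odd_euler_nth finite_atMost ball_triv simp_thms)
qed auto

end
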